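(* Let $(A,\cdot,\alpha)$ be a Hom-associative algebra acting on a Hom-associative algebra $(V,\cdot_V,\beta)$ via $(V,l,r,\beta,\cdot_V)$, and let $\mathcal H:V\to A$ be a homomorphic relative averaging operator. Then the operations $$u\dashv_{\mathcal H}v=r(\mathcal H(v))u,\qquad u\vdash_{\mathcal H}v=l(\mathcal H(u))v,\qquad u\,\bot_{\mathcal H}\,v=u\cdot_V v,\qquad u,v\in V,$$ make $V$ (with twisting map $\beta$) into a Hom-associative trialgebra.
   Context: All vector spaces are over a field $\mathbb K$ of characteristic $0$. All Hom-algebras are multiplicative, i.e. the twisting map preserves every bilinear operation of the structure. A Hom-associative algebra $(A,\cdot,\alpha)$ is a vector space $A$ with a bilinear operation $\cdot$ and a linear map $\alpha:A\to A$ such that $(x\cdot y)\cdot\alpha(z)=\alpha(x)\cdot(y\cdot z)$ for all $x,y,z\in A$. A bimodule $(V,l,r,\beta)$ of $(A,\cdot,\alpha)$ is a vector space $V$ with a linear map $\beta:V\to V$ and linear maps $l,r:A\to \mathrm{End}(V)$ such that for all $x,y\in A$: $\beta l(x)=l(\alpha(x))\beta$, $\beta r(x)=r(\alpha(x))\beta$, $l(x\cdot y)\beta=l(\alpha(x))l(y)$, $r(x\cdot y)\beta=r(\alpha(y))r(x)$, $l(\alpha(x))r(y)=r(\alpha(y))l(x)$. $(A,\cdot,\alpha)$ acts on a Hom-associative algebra $(V,\cdot_V,\beta)$ via $(V,l,r,\beta,\cdot_V)$ if $(V,l,r,\beta)$ is a bimodule of $A$ and for all $x\in A$, $u,v\in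 V$: $l(\alpha(x))(u\cdot_V v)=(l(x)u)\cdot_V\beta(v)$, $r(\alpha(x))(u\cdot_V v)=\beta(u)\cdot_V(r(x)v)$, $\beta(u)\cdot_V(l(x)v)=(r(x)u)\cdot_V\beta(v)$. A linear map $\mathcal H:V\to A$ is a homomorphic relative averaging operator if $\mathcal H\beta=\alpha\mathcal H$ and $\mathcal H(u)\cdot\mathcal H(v)=\mathcal H(l(\mathcal H(u))v)=\mathcal H(r(\mathcal H(v))u)=\mathcal H(u\cdot_V v)$ for all $u,v\in V$. A Hom-associative dialgebra $(D,\vdash,\dashv,\alpha)$ is a vector space with bilinear operations $\vdash,\dashv$ and a linear map $\alpha$ such that for all $x,y,z$: $(x\dashv y)\vdash\alpha(z)=(x\vdash y)\vdash\alpha(z)$; $\alpha(x)\dashv(y\dashv z)=\alpha(x)\dashv(y\vdash z)$; $(x\dashv y)\dashv\alpha(z)=\alpha(x)\dashv(y\dashv z)$; $(x\vdash y)\vdash\alpha(z)=\alpha(x)\vdash(y\vdash z)$; $(x\vdash y)\dashv\alpha(z)=\alpha(x)\vdash(y\dashv z)$. A Hom-associative trialgebra $(D,\vdash,\dashv,\bot,\alpha)$ consists of a Hom-associative dialgebra $(D,\vdash,\dashv,\alpha)$ and a Hom-associative algebra $(D,\bot,\alpha)$ such that for all $x,y,z\in D$: $(x\dashv y)\dashv\alpha(z)=\alpha(x)\dashv(y\,\bot\,z)$; $(x\,\bot\,y)\dashv\alpha(z)=\alpha(x)\,\bot\,(y\dashv z)$; $(x\dashv y)\,\bot\,\alpha(z)=\alpha(x)\,\bot\,(y\vdash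 z)$; $(x\vdash y)\,\bot\,\alpha(z)=\alpha(x)\vdash(y\,\bot\,z)$; $(x\,\bot\,y)\vdash\alpha(z)=\alpha(x)\vdash(y\vdash z)$. *)

theory Defs
  imports Complex_Main
begin

text \<open>A vector space over a field of characteristic 0 is a type of class
  \<open>ab_group_add\<close> with a scalar multiplication satisfying the locale
  \<open>vector_space\<close>, the scalars being of class \<open>field_char_0\<close>. The locale
  \<open>Vector_Spaces.linear\<close> includes the vector space laws for domain and codomain.\<close>

text \<open>Read in curried form, this also says that \<open>f\<close> is a linear map from the first
  space into the linear maps from the second space to the third.\<close>

definition bilinear_map ::
  "('k::field_char_0 \<Rightarrow> 'a::ab_group_add \<Rightarrow> 'a) \<Rightarrow> ('k \<Rightarrow> 'b::ab_group_add \<Rightarrow> 'b)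
    \<Rightarrow> ('k \<Rightarrow> 'c::ab_group_add \<Rightarrow> 'c) \<Rightarrow> ('a \<Rightarrow> 'b \<Rightarrow> 'c) \<Rightarrow> bool"
  where "bilinear_map s1 s2 s3 f \<longleftrightarrow>
    (\<forall>x. Vector_Spaces.linear s2 s3 (f x)) \<and> (\<forall>y. Vector_Spaces.linear s1 s3 (\<lambda>x. f x y))"

locale hom_algebra =
  fixes scale :: "'k::field_char_0 \<Rightarrow> 'a::ab_group_add \<Rightarrow> 'a"
    and mult :: "'a \<Rightarrow> 'a \<Rightarrow> 'a"
    and \<alpha> :: "'a \<Rightarrow> 'a"
  assumes vector_space: "vector_space scale"
    and bilinear_mult: "bilinear_map scale scale scale mult"
    and linear_twist: "Vector_Spaces.linear scale scale \<alpha>"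
    and multiplicative: "\<alpha> (mult x y) = mult (\<alpha> x) (\<alpha> y)"

locale hom_assoc_algebra = hom_algebra +
  assumes hom_assoc: "mult (mult x y) (\<alpha> z) = mult (\<alpha> x) (mult y z)"

locale hom_bimodule = hom_assoc_algebra scaleA multA \<alpha>
  for scaleA :: "'k::field_char_0 \<Rightarrow> 'a::ab_group_add \<Rightarrow> 'a" and multA and \<alpha> +
  fixes scaleV :: "'k \<Rightarrow> 'v::ab_group_add \<Rightarrow> 'v"
    and l :: "'a \<Rightarrow> 'v \<Rightarrow> 'v"
    and r :: "'a \<Rightarrow> 'v \<Rightarrow> 'v"
    and \<beta> :: "'v \<Rightarrow> 'v"
  assumes vector_space_V: "vector_space scaleV"
    and linear_\<beta>: "Vector_Spaces.linear scaleV scaleV \<beta>"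
    and linear_l: "bilinear_map scaleA scaleV scaleV l"
    and linear_r: "bilinear_map scaleA scaleV scaleV r"
    and \<beta>_l: "\<beta> \<circ> l x = l (\<alpha> x) \<circ> \<beta>"
    and \<beta>_r: "\<beta> \<circ> r x = r (\<alpha> x) \<circ> \<beta>"
    and l_mult: "l (multA x y) \<circ> \<beta> = l (\<alpha> x) \<circ> l y"
    and r_mult: "r (multA x y) \<circ> \<beta> = r (\<alpha> y) \<circ> r x"
    and l_r: "l (\<alpha> x) \<circ> r y = r (\<alpha> y) \<circ> l x"

locale hom_assoc_action =
  hom_bimodule scaleA multA \<alpha> scaleV l r \<beta> +
  V: hom_assoc_algebra scaleV multV \<beta>
  for scaleA :: "'k::field_char_0 \<Rightarrow> 'a::ab_group_add \<Rightarrow> 'a" and multA and \<alpha>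
    and scaleV :: "'k \<Rightarrow> 'v::ab_group_add \<Rightarrow> 'v" and multV and \<beta> and l and r +
  assumes action_l: "l (\<alpha> x) (multV u v) = multV (l x u) (\<beta> v)"
    and action_r: "r (\<alpha> x) (multV u v) = multV (\<beta> u) (r x v)"
    and action_mid: "multV (\<beta> u) (l x v) = multV (r x u) (\<beta> v)"

locale homomorphic_rel_averaging_operator =
  hom_assoc_action scaleA multA \<alpha> scaleV multV \<beta> l r
  for scaleA :: "'k::field_char_0 \<Rightarrow> 'a::ab_group_add \<Rightarrow> 'a" and multA and \<alpha>
    and scaleV :: "'k \<Rightarrow> 'v::ab_group_add \<Rightarrow> 'v" and multV and \<beta> and l and r +
  fixes H :: "'v \<Rightarrow> 'a"
  assumes linear_H: "Vector_Spaces.linear scaleV scaleA H"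
    and H_twist: "H \<circ> \<beta> = \<alpha> \<circ> H"
    and H_l: "multA (H u) (H v) = H (l (H u) v)"
    and H_r: "multA (H u) (H v) = H (r (H v) u)"
    and H_mult: "multA (H u) (H v) = H (multV u v)"

text \<open>In the dialgebra and trialgebra locales, \<open>lp\<close> is the operation \<open>\<turnstile>\<close>,
  \<open>rp\<close> is \<open>\<stileturn>\<close> and \<open>bt\<close> is \<open>\<bottom>\<close>.\<close>

locale hom_assoc_dialgebra =
  lp: hom_algebra scale lp \<alpha> + rp: hom_algebra scale rp \<alpha>
  for scale :: "'k::field_char_0 \<Rightarrow> 'a::ab_group_add \<Rightarrow> 'a"
    and lp (infixl "\<turnstile>" 70) and rp (infixl "\<stileturn>" 70) and \<alpha> +
  assumes di1: "(x \<stileturn> y) \<turnstile> \<alpha> z = (x \<turnstile> y) \<turnstile> \<alpha> z"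
    and di2: "\<alpha> x \<stileturn> (y \<stileturn> z) = \<alpha> x \<stileturn> (y \<turnstile> z)"
    and di3: "(x \<stileturn> y) \<stileturn> \<alpha> z = \<alpha> x \<stileturn> (y \<stileturn> z)"
    and di4: "(x \<turnstile> y) \<turnstile> \<alpha> z = \<alpha> x \<turnstile> (y \<turnstile> z)"
    and di5: "(x \<turnstile> y) \<stileturn> \<alpha> z = \<alpha> x \<turnstile> (y \<stileturn> z)"

locale hom_assoc_trialgebra =
  hom_assoc_dialgebra scale lp rp \<alpha> + bt: hom_assoc_algebra scale bt \<alpha>
  for scale :: "'k::field_char_0 \<Rightarrow> 'a::ab_group_add \<Rightarrow> 'a"
    and lp (infixl "\<turnstile>" 70) and rp (infixl "\<stileturn>" 70) and bt (infixl "\<bottom>" 70) and \<alpha> +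
  assumes tri1: "(x \<stileturn> y) \<stileturn> \<alpha> z = \<alpha> x \<stileturn> (y \<bottom> z)"
    and tri2: "(x \<bottom> y) \<stileturn> \<alpha> z = \<alpha> x \<bottom> (y \<stileturn> z)"
    and tri3: "(x \<stileturn> y) \<bottom> \<alpha> z = \<alpha> x \<bottom> (y \<turnstile> z)"
    and tri4: "(x \<turnstile> y) \<bottom> \<alpha> z = \<alpha> x \<turnstile> (y \<bottom> z)"
    and tri5: "(x \<bottom> y) \<turnstile> \<alpha> z = \<alpha> x \<turnstile> (y \<turnstile> z)"

end

theory Submission
  imports Defs
begin

text \<open>
  The four elements \<open>H (l (H u) v)\<close>, \<open>H (r (H v) u)\<close>, \<open>H (multV u v)\<close> and
  \<open>multA (H u) (H v)\<close> coincide. Inside an argument of \<open>H\<close> the three operations on \<open>V\<close>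
  are therefore indistinguishable, and \<open>H\<close> carries each of them to the product of \<open>A\<close>.
  Together with \<open>H (\<beta> u) = \<alpha> (H u)\<close> this reduces the axioms to laws of the action at
  elements \<open>H u\<close>. Where a factor \<open>y \<stileturn> z\<close>, \<open>y \<turnstile> z\<close> or \<open>y \<bottom> z\<close> occurs only inside \<open>H\<close>,
  it acts through \<open>multA (H y) (H z)\<close>, and the laws for \<open>l (multA x y)\<close> and \<open>r (multA x y)\<close>
  apply. The axiom \<open>(x \<turnstile> y) \<stileturn> \<beta> z = \<beta> x \<turnstile> (y \<stileturn> z)\<close> is the commutation of \<open>l\<close> with \<open>r\<close>.
  The axioms whose two sides mix an outer \<open>\<bottom>\<close> with \<open>\<turnstile>\<close> or \<open>\<stileturn>\<close> are the compatibility
  of \<open>l\<close> and \<open>r\<close> with \<open>multV\<close>, and the axioms on \<open>\<bottom>\<close> alone are those of \<open>V\<close>.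
\<close>

lemma bilinear_map_precompose_left:
  assumes f: "bilinear_map s2 s3 s4 f" and g: "Vector_Spaces.linear s1 s2 g"
  shows "bilinear_map s1 s3 s4 (\<lambda>x. f (g x))"
  using f Vector_Spaces.linear_compose[OF g] unfolding bilinear_map_def by (auto simp: o_def)

lemma bilinear_map_flip:
  "bilinear_map s1 s2 s3 f \<Longrightarrow> bilinear_map s2 s1 s3 (\<lambda>x y. f y x)"
  unfolding bilinear_map_def by auto

context homomorphic_rel_averaging_operator
begin

text \<open>The laws of the definitions relate compositions of maps; rewriting needs them applied
  to elements.\<close>

lemma H_twist_apply: "H (\<beta> u) = \<alpha> (H u)"
  using H_twist by (metis comp_apply)

lemma twist_l_apply: "\<beta> (l x v) = l (\<alpha> x) (\<beta> v)"
  using \<beta>_l by (metis comp_apply)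

lemma twist_r_apply: "\<beta> (r x v) = r (\<alpha> x) (\<beta> v)"
  using \<beta>_r by (metis comp_apply)

lemma l_mult_apply: "l (multA x y) (\<beta> v) = l (\<alpha> x) (l y v)"
  using l_mult by (metis comp_apply)

lemma r_mult_apply: "r (multA x y) (\<beta> v) = r (\<alpha> y) (r x v)"
  using r_mult by (metis comp_apply)

lemma l_r_apply: "l (\<alpha> x) (r y v) = r (\<alpha> y) (l x v)"
  using l_r by (metis comp_apply)

lemma hom_algebra_left: "hom_algebra scaleV (\<lambda>u v. l (H u) v) \<beta>"
  by (rule hom_algebra.intro)
    (simp_all add: bilinear_map_precompose_left[OF linear_l linear_H] linear_\<beta>
      twist_l_apply H_twist_apply V.vector_space)

lemma hom_algebra_right: "hom_algebra scaleV (\<lambda>u v. r (H v) u) \<beta>"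
  by (rule hom_algebra.intro)
    (simp_all add: bilinear_map_flip[OF bilinear_map_precompose_left[OF linear_r linear_H]]
      linear_\<beta> twist_r_apply H_twist_apply V.vector_space)

lemma hom_assoc_dialgebra_V:
  "hom_assoc_dialgebra scaleV (\<lambda>u v. l (H u) v) (\<lambda>u v. r (H v) u) \<beta>"
proof -
  interpret lp: hom_algebra scaleV "\<lambda>u v. l (H u) v" \<beta> by (rule hom_algebra_left)
  interpret rp: hom_algebra scaleV "\<lambda>u v. r (H v) u" \<beta> by (rule hom_algebra_right)
  show ?thesis
    by unfold_locales
      (simp_all add: H_l[symmetric] H_r[symmetric] H_twist_apply l_mult_apply r_mult_apply
        l_r_apply)
qed

lemma hom_assoc_trialgebra_V:
  "hom_assoc_trialgebra scaleV (\<lambda>u v. l (H u) v) (\<lambda>u v. r (H v) u) (\<lambda>u v. multV u v) \<beta>"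
proof -
  interpret di: hom_assoc_dialgebra scaleV "\<lambda>u v. l (H u) v" "\<lambda>u v. r (H v) u" \<beta>
    by (rule hom_assoc_dialgebra_V)
  show ?thesis
    by unfold_locales
      (simp_all add: H_mult[symmetric] H_twist_apply l_mult_apply r_mult_apply
        action_l action_r action_mid)
qed

end

theorem theorem4p13:
  fixes scaleA :: "'k::field_char_0 \<Rightarrow> 'a::ab_group_add \<Rightarrow> 'a"
    and multA :: "'a \<Rightarrow> 'a \<Rightarrow> 'a" and \<alpha> :: "'a \<Rightarrow> 'a"
    and scaleV :: "'k \<Rightarrow> 'v::ab_group_add \<Rightarrow> 'v"
    and multV :: "'v \<Rightarrow> 'v \<Rightarrow> 'v" and \<beta> :: "'v \<Rightarrow> 'v"
    and l r :: "'a \<Rightarrow> 'v \<Rightarrow> 'v" and H :: "'v \<Rightarrow> 'a"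
  assumes "hom_assoc_action scaleA multA \<alpha> scaleV multV \<beta> l r"
    and "homomorphic_rel_averaging_operator scaleA multA \<alpha> scaleV multV \<beta> l r H"
  shows "hom_assoc_trialgebra scaleV (\<lambda>u v. l (H u) v) (\<lambda>u v. r (H v) u) (\<lambda>u v. multV u v) \<beta>"
  using assms(2) by (rule homomorphic_rel_averaging_operator.hom_assoc_trialgebra_V)

end
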